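(* Any disagreement bound $f$ satisfies $$f(x)\ge \frac{2x}{1+\frac{1}{\lfloor 1/x\rfloor}}\qquad\text{for every } x\in(0,1).$$ In particular, any disagreement bound $f$ satisfies $\liminf_{x\to0}\frac{f(x)}{x}\ge 2$.
   Context: A coupling of a collection of random variables $(X_i)_{i\in I}$ is a family $(X_i')_{i\in I}$ of random variables on one common probability space such that each $X_i'$ has the same law as $X_i$; primes are omitted. The total variation distance is $d_{\mathrm{TV}}(X,Y)=\sup_A|\mathbb P(X\in A)-\mathbb P(Y\in A)|$, over all measurable sets $A$. A function $f:[0,1]\to[0,1]$ is called a disagreement bound if for any finite collection of random variables there is a coupling of the variables such that any two of them, say $X$ and $Y$, satisfy $\mathbb P(X\neq Y)\le f(d_{\mathrm{TV}}(X,Y))$. *)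

theory Defs
  imports "HOL-Probability.Probability"
begin

(* X and Y are random variables on possibly different probability spaces P and Q,
   both with values in the measurable space M. *)
definition tv_dist ::
  "'a measure \<Rightarrow> 'w measure \<Rightarrow> ('w \<Rightarrow> 'a) \<Rightarrow> 'v measure \<Rightarrow> ('v \<Rightarrow> 'a) \<Rightarrow> real" where
  "tv_dist M P X Q Y =
     (SUP A\<in>sets M. \<bar>measure P {\<omega> \<in> space P. X \<omega> \<in> A} - measure Q {\<omega> \<in> space Q. Y \<omega> \<in> A}\<bar>)"

definition is_coupling ::
  "'i set \<Rightarrow> 'a measure \<Rightarrow> ('i \<Rightarrow> 'w measure) \<Rightarrow> ('i \<Rightarrow> 'w \<Rightarrow> 'a)
    \<Rightarrow> 'v measure \<Rightarrow> ('i \<Rightarrow> 'v \<Rightarrow> 'a) \<Rightarrow> bool" where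
  "is_coupling I M P X Q X' \<longleftrightarrow>
     prob_space Q \<and>
     (\<forall>i\<in>I. X' i \<in> measurable Q M \<and> distr Q M (X' i) = distr (P i) M (X i))"

(* HOL cannot quantify over types inside a formula, so the values of the random variables
   range over measurable spaces M whose points have the type 'a.  Every set of such points
   and every sigma-algebra on it is allowed.

   The remaining choices of types lose nothing.  A finite collection can be indexed by
   natural numbers.  Couplings and total variation distances depend only on the laws of the
   given variables, and every law on M is that of the identity on a sample space of type 'a.
   Any coupling can be transported along the map taking a sample point to the tuple of
   values of all the variables, which gives a coupling on a space of type nat => 'a (with
   the image sigma-algebra, so that the events of disagreement stay measurable).

   The diagonal of M need not be measurable.  For P(X \<noteq> Y) to make sense it is required
   that {X \<noteq> Y} is an event of the space carrying the coupling; when the diagonal is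
   measurable this holds automatically. *)
definition disagreement_bound :: "'a itself \<Rightarrow> (real \<Rightarrow> real) \<Rightarrow> bool" where
  "disagreement_bound (_ :: 'a itself) f \<longleftrightarrow>
     f \<in> {0..1} \<rightarrow> {0..1} \<and>
     (\<forall>(M :: 'a measure) (I :: nat set) (P :: nat \<Rightarrow> 'a measure) (X :: nat \<Rightarrow> 'a \<Rightarrow> 'a).
        finite I \<longrightarrow> (\<forall>i\<in>I. prob_space (P i) \<and> X i \<in> measurable (P i) M) \<longrightarrow>
        (\<exists>(Q :: (nat \<Rightarrow> 'a) measure) X'.
           is_coupling I M P X Q X' \<and>
           (\<forall>i\<in>I. \<forall>j\<in>I. i \<noteq> j \<longrightarrow>
              {\<omega> \<in> space Q. X' i \<omega> \<noteq> X' j \<omega>} \<in> sets Q \<and>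
              measure Q {\<omega> \<in> space Q. X' i \<omega> \<noteq> X' j \<omega>}
                \<le> f (tv_dist M (P i) (X i) (P j) (X j)))))"

end

theory Submission
  imports Defs
begin

text \<open>
  With \<open>n = \<lfloor>1/x\<rfloor>\<close>, consider \<open>n + 1\<close> variables, where the \<open>i\<close>-th takes each of the values
  \<open>j \<in> {0..n} - {i}\<close> with probability \<open>x\<close> and a further common value with the remaining
  probability \<open>1 - n x\<close>. Any two of them are at total variation distance \<open>x\<close>. In a coupling
  they can all agree only at the common value, so they are not all equal with probability at
  least \<open>n x\<close>, and then at least \<open>n\<close> of the \<open>n (n + 1) / 2\<close> pairs disagree. Some pair thus
  disagrees with probability at least \<open>2 n x / (n + 1)\<close>.
\<close>

section \<open>Counting disagreeing pairs\<close>

text \<open>Split the \<open>n + 1\<close> indices into those agreeing with index 0 and the rest.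
  Both classes are nonempty, of sizes \<open>a + 1\<close> and \<open>b + 1\<close> with
  \<open>a + b + 1 = n\<close>, and \<open>2 (a + 1) (b + 1)\<close> is at least
  \<open>2 (a + b + 1)\<close>. The factor 2 comes from counting ordered pairs.\<close>

lemma card_disagreeing_pairs_ge:
  fixes Y :: "nat \<Rightarrow> 'b"
  assumes "k \<le> n" "Y k \<noteq> Y 0"
  shows "2 * n \<le> card {(i, j) \<in> {..n} \<times> {..n}. Y i \<noteq> Y j}"
proof -
  define A where "A = {i \<in> {..n}. Y i = Y 0}"
  define B where "B = {i \<in> {..n}. Y i \<noteq> Y 0}"
  have fin: "finite A" "finite B"
    by (auto simp: A_def B_def)
  have "0 \<in> A" "k \<in> B"
    using assms by (auto simp: A_def B_def)
  with fin have "card A > 0" "card B > 0"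
    by (auto simp: card_gt_0_iff)
  then obtain a b where ab: "card A = Suc a" "card B = Suc b"
    by (meson gr0_implies_Suc)
  have "card A + card B = card (A \<union> B)"
    using fin by (intro card_Un_disjoint [symmetric]) (auto simp: A_def B_def)
  also have "A \<union> B = {..n}"
    by (auto simp: A_def B_def)
  finally have "n = Suc (a + b)"
    using ab by simp
  then have "2 * n \<le> card A * card B + card B * card A"
    by (simp add: ab)
  also have "\<dots> = card (A \<times> B \<union> B \<times> A)"
    using fin by (subst card_Un_disjoint) (auto simp: A_def B_def)
  also have "\<dots> \<le> card {(i, j) \<in> {..n} \<times> {..n}. Y i \<noteq> Y j}"
    by (rule card_mono) (auto intro: finite_subset [of _ "{..n} \<times> {..n}"] simp: A_def B_def)
  finally show ?thesis .
qed

text \<open>Integrating the pointwise count turns it into a bound on the sum of disagreement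
  probabilities. The values carry no sigma-algebra here, so measurability is asked of the
  disagreement events themselves.\<close>

lemma (in prob_space) expected_disagreements_ge:
  fixes Y :: "nat \<Rightarrow> 'a \<Rightarrow> 'b"
  assumes D: "\<And>i j. i \<le> n \<Longrightarrow> j \<le> n \<Longrightarrow> {\<omega> \<in> space M. Y i \<omega> \<noteq> Y j \<omega>} \<in> events"
    and N: "N \<in> events"
    and ae: "AE \<omega> in M. \<omega> \<in> N \<longrightarrow> (\<exists>k\<le>n. Y k \<omega> \<noteq> Y 0 \<omega>)"
  shows "2 * real n * prob N
    \<le> (\<Sum>(i, j)\<in>{..n} \<times> {..n}. prob {\<omega> \<in> space M. Y i \<omega> \<noteq> Y j \<omega>})"
proof -
  define S where "S = (\<lambda>(i, j). {\<omega> \<in> space M. Y i \<omega> \<noteq> Y j \<omega>})"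
  have S: "S p \<in> events" if "p \<in> {..n} \<times> {..n}" for p
    using that D by (auto simp: S_def)
  have int: "integrable M (\<lambda>\<omega>. \<Sum>p\<in>{..n} \<times> {..n}. indicat_real (S p) \<omega>)"
    using S by (intro Bochner_Integration.integrable_sum integrable_real_indicator)
      (auto simp: emeasure_eq_measure)
  have "2 * real n * prob N = (\<integral>\<omega>. 2 * real n * indicator N \<omega> \<partial>M)"
    using N by simp
  also have "\<dots> \<le> (\<integral>\<omega>. (\<Sum>p\<in>{..n} \<times> {..n}. indicator (S p) \<omega>) \<partial>M)"
  proof (rule integral_mono_AE)
    show "integrable M (\<lambda>\<omega>. 2 * real n * indicator N \<omega>)"
      using N by (simp add: emeasure_eq_measure)
    \<comment> \<open>The right-hand side counts the ordered pairs that disagree at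
      \<open>\<omega>\<close>. On \<open>N\<close> the counting lemma applies; off \<open>N\<close>
      the left-hand side is 0.\<close>
    show "AE \<omega> in M. 2 * real n * indicator N \<omega> \<le> (\<Sum>p\<in>{..n} \<times> {..n}. indicator (S p) \<omega>)"
      using ae
    proof (rule AE_mp, intro AE_I2 impI)
      fix \<omega>
      assume \<omega>: "\<omega> \<in> space M" and imp: "\<omega> \<in> N \<longrightarrow> (\<exists>k\<le>n. Y k \<omega> \<noteq> Y 0 \<omega>)"
      have "(\<Sum>p\<in>{..n} \<times> {..n}. indicator (S p) \<omega>)
          = (\<Sum>p\<in>{..n} \<times> {..n}. if p \<in> {(i, j). Y i \<omega> \<noteq> Y j \<omega>} then 1 else (0::real))"
        using \<omega> by (intro sum.cong) (auto simp: S_def indicator_def)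
      also have "\<dots> = real (card {(i, j) \<in> {..n} \<times> {..n}. Y i \<omega> \<noteq> Y j \<omega>})"
        by (subst sum.inter_restrict [symmetric])
          (auto intro!: arg_cong [where f = card])
      finally have sum_eq: "(\<Sum>p\<in>{..n} \<times> {..n}. indicator (S p) \<omega>)
          = real (card {(i, j) \<in> {..n} \<times> {..n}. Y i \<omega> \<noteq> Y j \<omega>})" .
      show "2 * real n * indicator N \<omega> \<le> (\<Sum>p\<in>{..n} \<times> {..n}. indicator (S p) \<omega>)"
      proof (cases "\<omega> \<in> N")
        case True
        with imp obtain k where "k \<le> n" "Y k \<omega> \<noteq> Y 0 \<omega>"
          by blast
        from card_disagreeing_pairs_ge [of k n "\<lambda>i. Y i \<omega>", OF this]
        have "real (2 * n) \<le> real (card {(i, j) \<in> {..n} \<times> {..n}. Y i \<omega> \<noteq> Y j \<omega>})"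
          by (rule of_nat_mono)
        then show ?thesis
          using True by (simp add: sum_eq)
      qed (simp add: sum_eq)
    qed
  qed (rule int)
  also have "\<dots> = (\<Sum>p\<in>{..n} \<times> {..n}. prob (S p))"
    using S by (subst Bochner_Integration.integral_sum) (auto simp: emeasure_eq_measure)
  finally show ?thesis
    by (simp add: S_def case_prod_unfold)
qed

section \<open>Laws at pairwise distance \<open>x\<close>\<close>

text \<open>\<open>Suc n\<close> plays the role of the common value, and \<open>i\<close> is the
  value that the \<open>i\<close>-th variable must avoid.\<close>

definition punctured_pmf :: "nat \<Rightarrow> real \<Rightarrow> nat \<Rightarrow> nat pmf" where
  "punctured_pmf n x i = embed_pmf (\<lambda>k. if k = i then 0 else if k \<le> n then x
     else if k = Suc n then 1 - real n * x else 0)"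

lemma pmf_punctured:
  assumes "0 \<le> x" "real n * x \<le> 1" "i \<le> n"
  shows "pmf (punctured_pmf n x i) k = (if k = i then 0 else if k \<le> n then x
     else if k = Suc n then 1 - real n * x else 0)"
  unfolding punctured_pmf_def
proof (rule pmf_embed_pmf)
  let ?g = "\<lambda>k. if k = i then 0 else if k \<le> n then x
     else if k = Suc n then 1 - real n * x else 0"
  show nonneg: "0 \<le> ?g k" for k
    using assms by simp
  have "(\<integral>\<^sup>+k. ennreal (?g k) \<partial>count_space UNIV) = (\<Sum>k\<le>Suc n. ennreal (?g k))"
    using assms by (intro nn_integral_count_space') auto
  also have "\<dots> = ennreal (\<Sum>k\<le>Suc n. ?g k)"
    using nonneg by (intro sum_ennreal)
  also have "(\<Sum>k\<le>Suc n. ?g k) = (\<Sum>k\<le>n. ?g k) + (1 - real n * x)"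
    using assms by simp
  \<comment> \<open>The entry at \<open>i\<close> vanishes, which leaves \<open>n\<close> terms
    equal to \<open>x\<close>; the mass at \<open>Suc n\<close> completes them to 1.\<close>
  also have "(\<Sum>k\<le>n. ?g k) = (\<Sum>k\<in>{..n} - {i}. x)"
    using assms by (subst sum.remove [of _ i]) (auto intro!: sum.cong)
  also have "\<dots> = real n * x"
    using assms by simp
  finally show "(\<integral>\<^sup>+k. ennreal (?g k) \<partial>count_space UNIV) = 1"
    by simp
qed

text \<open>In this form \<open>i\<close> enters only through \<open>indicator A i\<close>, so
  everything else cancels when two such laws are subtracted.\<close>

lemma measure_punctured:
  assumes "0 \<le> x" "real n * x \<le> 1" "i \<le> n"
  shows "measure (punctured_pmf n x i) A
    = x * (real (card (A \<inter> {..n})) - indicator A i) + (1 - real n * x) * indicator A (Suc n)"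
proof -
  let ?p = "punctured_pmf n x i"
  have supp: "set_pmf ?p \<subseteq> {..Suc n}"
    using assms by (auto simp: set_pmf_iff pmf_punctured split: if_splits)
  have "measure ?p A = measure ?p (A \<inter> {..Suc n})"
    using supp by (intro measure_pmf.finite_measure_eq_AE) (auto simp: AE_measure_pmf_iff)
  also have "\<dots> = (\<Sum>k\<in>A \<inter> {..Suc n}. pmf ?p k)"
    by (rule measure_measure_pmf_finite) simp
  also have "\<dots> = (\<Sum>k\<le>Suc n. if k \<in> A then pmf ?p k else 0)"
    by (subst Int_commute) (simp only: sum.inter_restrict finite_atMost)
  also have "\<dots> = (\<Sum>k\<le>n. if k \<in> A then pmf ?p k else 0) + (1 - real n * x) * indicator A (Suc n)"
    using assms by (simp add: pmf_punctured)
  also have "(\<Sum>k\<le>n. if k \<in> A then pmf ?p k else 0)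
      = (\<Sum>k\<le>n. (if k \<in> A then x else 0) - (if k = i then x * indicator A i else 0))"
    using assms by (intro sum.cong) (auto simp: pmf_punctured)
  also have "\<dots> = x * (real (card (A \<inter> {..n})) - indicator A i)"
    using assms by (simp add: sum_subtractf sum.inter_restrict [symmetric] Int_commute algebra_simps)
  finally show ?thesis .
qed

text \<open>The two laws differ only in their missing atoms \<open>e i\<close> and
  \<open>e j\<close>, each worth \<open>x\<close>. The set \<open>{e j}\<close> attains the
  supremum: it has mass \<open>x\<close> under \<open>P i\<close> and 0 under \<open>P j\<close>.
  The injection \<open>e\<close> carries the values into the type in question.\<close>

lemma tv_dist_punctured:
  fixes e :: "nat \<Rightarrow> 'a"
  assumes "0 \<le> x" "real n * x \<le> 1" "i \<le> n" "j \<le> n" "i \<noteq> j" "inj e"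
  defines "P \<equiv> \<lambda>i. measure_pmf (map_pmf e (punctured_pmf n x i))"
  shows "tv_dist (count_space UNIV) (P i) id (P j) id = x"
proof -
  have diff: "\<bar>measure (P i) A - measure (P j) A\<bar> = x * \<bar>indicator A (e j) - indicator A (e i)\<bar>" for A
    using assms by (simp add: P_def measure_punctured abs_mult indicator_vimage flip: right_diff_distrib)
  show ?thesis
    unfolding tv_dist_def
  proof (rule cSup_eq_maximum)
    show "x \<in> (\<lambda>A. \<bar>measure (P i) {\<omega> \<in> space (P i). id \<omega> \<in> A}
        - measure (P j) {\<omega> \<in> space (P j). id \<omega> \<in> A}\<bar>) ` sets (count_space UNIV)"
      using assms(5) \<open>inj e\<close> diff [of "{e j}"]
      by (intro image_eqI [of _ _ "{e j}"]) (auto simp: P_def inj_eq)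
  next
    fix y
    assume "y \<in> (\<lambda>A. \<bar>measure (P i) {\<omega> \<in> space (P i). id \<omega> \<in> A}
        - measure (P j) {\<omega> \<in> space (P j). id \<omega> \<in> A}\<bar>) ` sets (count_space UNIV)"
    then obtain A where "y = \<bar>measure (P i) A - measure (P j) A\<bar>"
      by (auto simp: P_def)
    then show "y \<le> x"
      using \<open>0 \<le> x\<close> by (simp add: diff indicator_def)
  qed
qed

section \<open>The lower bound for each admissible \<open>n\<close>\<close>

text \<open>The \<open>n (n + 1)\<close> ordered pairs of distinct indices have disagreement
  probabilities at most \<open>f x\<close>, while their sum is at least \<open>2 n\<close> times
  \<open>n x\<close>. Dividing by \<open>n (n + 1)\<close> gives the claim. Infinitely many points
  leave room for the \<open>n + 2\<close> values, whatever \<open>n\<close> is.\<close>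

lemma disagreement_bound_ge:
  assumes inf: "infinite (UNIV :: 'a set)"
    and f: "disagreement_bound TYPE('a) f"
    and x: "0 \<le> x" and n: "n > 0" "real n * x \<le> 1"
  shows "f x \<ge> 2 * real n * x / (real n + 1)"
proof -
  obtain e :: "nat \<Rightarrow> 'a" where e: "inj e"
    using infinite_countable_subset [OF inf] by auto
  define P where "P = (\<lambda>i. measure_pmf (map_pmf e (punctured_pmf n x i)))"
  have "prob_space (P i) \<and> id \<in> measurable (P i) (count_space UNIV)" for i
    by (auto simp: P_def measure_pmf.prob_space_axioms)
  then have "\<exists>(Q :: (nat \<Rightarrow> 'a) measure) Y. is_coupling {..n} (count_space UNIV) P (\<lambda>_. id) Q Y \<and>
      (\<forall>i\<in>{..n}. \<forall>j\<in>{..n}. i \<noteq> j \<longrightarrow> {\<omega> \<in> space Q. Y i \<omega> \<noteq> Y j \<omega>} \<in> sets Q \<and>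
         measure Q {\<omega> \<in> space Q. Y i \<omega> \<noteq> Y j \<omega>}
           \<le> f (tv_dist (count_space UNIV) (P i) id (P j) id))"
    by (intro f [unfolded disagreement_bound_def, THEN conjunct2, THEN spec, THEN spec, THEN spec,
          THEN spec, THEN mp, THEN mp]) simp_all
  then obtain Q :: "(nat \<Rightarrow> 'a) measure" and Y where
    coupling: "is_coupling {..n} (count_space UNIV) P (\<lambda>_. id) Q Y" and
    disagree: "\<forall>i\<in>{..n}. \<forall>j\<in>{..n}. i \<noteq> j \<longrightarrow> {\<omega> \<in> space Q. Y i \<omega> \<noteq> Y j \<omega>} \<in> sets Q \<and>
       measure Q {\<omega> \<in> space Q. Y i \<omega> \<noteq> Y j \<omega>}
         \<le> f (tv_dist (count_space UNIV) (P i) id (P j) id)"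
    by (elim exE conjE)
  have tv: "tv_dist (count_space UNIV) (P i) id (P j) id = x" if "i \<le> n" "j \<le> n" "i \<noteq> j" for i j
    using tv_dist_punctured [OF x n(2) that e] by (simp only: P_def)
  have Y: "{\<omega> \<in> space Q. Y i \<omega> \<noteq> Y j \<omega>} \<in> sets Q"
      "measure Q {\<omega> \<in> space Q. Y i \<omega> \<noteq> Y j \<omega>} \<le> f x"
    if "i \<le> n" "j \<le> n" "i \<noteq> j" for i j
    using disagree that by (auto simp flip: tv [OF that])
  interpret Q: prob_space Q
    using coupling by (simp add: is_coupling_def)
  have meas: "Y i \<in> measurable Q (count_space UNIV)" if "i \<le> n" for i
    using coupling that by (simp add: is_coupling_def)
  have law: "measure Q (Y i -` A \<inter> space Q) = measure (punctured_pmf n x i) (e -` A)"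
    if "i \<le> n" for i A
  proof -
    have "measure Q (Y i -` A \<inter> space Q) = measure (distr Q (count_space UNIV) (Y i)) A"
      using meas [OF that] by (subst measure_distr) auto
    also have "distr Q (count_space UNIV) (Y i) = distr (P i) (count_space UNIV) id"
      using coupling that by (simp add: is_coupling_def)
    also have "measure \<dots> A = measure (punctured_pmf n x i) (e -` A)"
      by (subst measure_distr) (auto simp: P_def)
    finally show ?thesis .
  qed
  \<comment> \<open>Almost surely, this is the event that variable 0 misses the common value
    \<open>e (Suc n)\<close>.\<close>
  define N where "N = Y 0 -` e ` {..n} \<inter> space Q"
  have N: "N \<in> sets Q"
    using meas [of 0] unfolding N_def by (intro measurable_sets) auto
  have prob_N: "measure Q N = real n * x"
    using x n e by (simp add: N_def law measure_punctured inj_vimage_image_eq)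
  have "AE \<omega> in Q. Y i \<omega> \<noteq> e i" if "i \<le> n" for i
  proof -
    have "measure Q (Y i -` {e i} \<inter> space Q) = measure (punctured_pmf n x i) {i}"
      using law [OF that, of "{e i}"] e by (simp add: vimage_def inj_eq)
    also have "\<dots> = 0"
      using x n that by (simp add: measure_pmf_single pmf_punctured)
    finally have "Y i -` {e i} \<inter> space Q \<in> null_sets Q"
      using meas [OF that] measurable_sets [OF meas [OF that], of "{e i}"]
      by (auto simp: null_sets_def Q.emeasure_eq_measure)
    from AE_not_in [OF this] show ?thesis
      by (rule AE_mp) (auto intro: AE_I2)
  qed
  then have "AE \<omega> in Q. \<forall>i\<in>{..n}. Y i \<omega> \<noteq> e i"
    by (intro AE_finite_allI) auto
  \<comment> \<open>On \<open>N\<close>, \<open>Y 0\<close> equals \<open>e k\<close> for some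
    \<open>k \<le> n\<close>, a value that \<open>Y k\<close> almost surely avoids; this
    \<open>k\<close> is the witness.\<close>
  then have ae: "AE \<omega> in Q. \<omega> \<in> N \<longrightarrow> (\<exists>k\<le>n. Y k \<omega> \<noteq> Y 0 \<omega>)"
    by (rule AE_mp) (auto simp: N_def intro!: AE_I2)
  \<comment> \<open>The coupling gives these events only for distinct indices; for
    \<open>i = j\<close> the event is empty.\<close>
  have D: "{\<omega> \<in> space Q. Y i \<omega> \<noteq> Y j \<omega>} \<in> sets Q" if "i \<le> n" "j \<le> n" for i j
    using Y(1) [OF that] by (cases "i = j") auto
  have "2 * real n * (real n * x)
      \<le> (\<Sum>(i, j)\<in>{..n} \<times> {..n}. measure Q {\<omega> \<in> space Q. Y i \<omega> \<noteq> Y j \<omega>})"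
    using Q.expected_disagreements_ge [OF D N ae] by (simp add: prob_N)
  also have "\<dots> = (\<Sum>i\<le>n. \<Sum>j\<le>n. measure Q {\<omega> \<in> space Q. Y i \<omega> \<noteq> Y j \<omega>})"
    by (simp add: sum.cartesian_product)
  \<comment> \<open>Keeping the diagonal terms at 0 leaves \<open>n (n + 1)\<close> copies of
    \<open>f x\<close> instead of \<open>(n + 1)^2\<close>, as the sharp constant requires.\<close>
  also have "\<dots> \<le> (\<Sum>i\<le>n. \<Sum>j\<le>n. if j = i then 0 else f x)"
    using Y(2) by (intro sum_mono) auto
  also have "\<dots> = (\<Sum>i\<le>n. \<Sum>j\<in>{..n} - {i}. f x)"
    by (rule sum.cong [OF refl], subst sum.remove) (auto intro!: sum.cong)
  also have "\<dots> = real n * ((real n + 1) * f x)"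
    by (simp add: algebra_simps)
  finally have "real n * (2 * real n * x) \<le> real n * ((real n + 1) * f x)"
    by (simp add: algebra_simps)
  then have "2 * real n * x \<le> (real n + 1) * f x"
    using n by simp
  then show ?thesis
    by (simp add: divide_simps mult.commute)
qed

section \<open>Choice of \<open>n\<close> and the limit at 0\<close>

theorem proposition8:
  fixes f :: "real \<Rightarrow> real"
  assumes "infinite (UNIV :: 'a set)"
    and "disagreement_bound TYPE('a) f"
  shows "(\<forall>x\<in>{0<..<1}. f x \<ge> 2 * x / (1 + 1 / real_of_int \<lfloor>1 / x\<rfloor>)) \<and>
         Liminf (at_right 0) (\<lambda>x. ereal (f x / x)) \<ge> 2"
proof
  have floor_pos: "real_of_int \<lfloor>1 / x\<rfloor> \<ge> 1" if "0 < x" "x < 1" for x :: real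
    using that by simp
  show bound: "\<forall>x\<in>{0<..<1}. f x \<ge> 2 * x / (1 + 1 / real_of_int \<lfloor>1 / x\<rfloor>)"
  proof
    fix x :: real
    assume "x \<in> {0<..<1}"
    then have x: "0 < x" "x < 1"
      by auto
    \<comment> \<open>The bound \<open>2 n x / (n + 1)\<close> increases with \<open>n\<close>, and
      this is the largest \<open>n\<close> with \<open>n x \<le> 1\<close>.\<close>
    define n where "n = nat \<lfloor>1 / x\<rfloor>"
    have n: "real n = real_of_int \<lfloor>1 / x\<rfloor>"
      using floor_pos [OF x] unfolding n_def by linarith
    have "real n \<le> 1 / x"
      by (simp add: n)
    then have "real n * x \<le> 1"
      using x by (simp add: field_simps)
    moreover have "n > 0"
      using floor_pos [OF x] n by linarith
    ultimately have "f x \<ge> 2 * real n * x / (real n + 1)"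
      using disagreement_bound_ge [OF assms] x by simp
    also have "2 * real n * x / (real n + 1) = 2 * x / (1 + 1 / real n)"
      using \<open>n > 0\<close> by (simp add: field_simps)
    finally show "f x \<ge> 2 * x / (1 + 1 / real_of_int \<lfloor>1 / x\<rfloor>)"
      by (simp add: n)
  qed
  \<comment> \<open>A continuous minorant removes the floor: with \<open>m\<close> the floor of
    \<open>1 / x\<close>, \<open>2 / (1 + 1 / m) = 2 (1 - 1 / (m + 1))\<close>, and
    \<open>1 / (m + 1) < x\<close>.\<close>
  have lower: "2 * (1 - x) \<le> f x / x" if x: "0 < x" "x < 1" for x
  proof -
    define m where "m = real_of_int \<lfloor>1 / x\<rfloor>"
    have m: "m \<ge> 1"
      using floor_pos [OF x] by (simp add: m_def)
    have "1 / x < m + 1"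
      by (simp add: m_def)
    then have "1 < (m + 1) * x"
      using x by (simp add: field_simps)
    then have "2 * (1 - x) \<le> 2 / (1 + 1 / m)"
      using m by (simp add: field_simps)
    also have "\<dots> = 2 * x / (1 + 1 / m) / x"
      using x by simp
    also have "\<dots> \<le> f x / x"
      using bound x by (intro divide_right_mono) (auto simp: m_def)
    finally show ?thesis .
  qed
  have "((\<lambda>x::real. ereal (2 * (1 - x))) \<longlongrightarrow> ereal (2 * (1 - 0))) (at_right 0)"
    by (intro tendsto_intros)
  then have "Liminf (at_right 0) (\<lambda>x::real. ereal (2 * (1 - x))) = ereal 2"
    by (intro lim_imp_Liminf) simp_all
  moreover have "Liminf (at_right 0) (\<lambda>x. ereal (2 * (1 - x)))
      \<le> Liminf (at_right 0) (\<lambda>x. ereal (f x / x))"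
    using lower by (intro Liminf_mono) (auto simp: eventually_at_right_field intro!: exI [of _ 1])
  ultimately show "Liminf (at_right 0) (\<lambda>x. ereal (f x / x)) \<ge> 2"
    by simp
qed

end
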